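(* Let $X$ be a hidden-variable team with measurement variables $\vec{x}=(x_0,\dots,x_{n-1})$, outcome variables $\vec{y}=(y_0,\dots,y_{n-1})$ and hidden variables $\vec{z}=(z_0,\dots,z_{l-1})$. Then $X$ satisfies locality if and only if $X$ satisfies the formula $$\Big(\bigwedge_{I\subseteq n}\{x_i\mid i\notin I\}\perp_{\{x_i\mid i\in I\}\vec{z}}\{y_i\mid i\in I\}\Big)\wedge\Big(\bigwedge_{i<n}y_i\perp_{\vec{x}\vec{z}}\{y_j\mid j\neq i\}\Big),$$ where $n$ is identified with $\{0,\dots,n-1\}$.
   Context: A hidden-variable team is a set $X$ of assignments (functions giving values to variables), all with domain the set of the $2n+l$ distinct variables $\{x_0,\dots,x_{n-1},y_0,\dots,y_{n-1},z_0,\dots,z_{l-1}\}$. For a tuple $\vec{v}$ of variables, $s(\vec{v})$ is the tuple of values; juxtaposition of tuples is concatenation, and sets of variables in atoms are read as tuples listing them. $X$ satisfies $\vec{u}\perp_{\vec{v}}\vec{w}$ if for all $s,s'\in X$ with $s(\vec{v})=s'(\vec{v})$ there is $s''\in X$ with $s''(\vec{v}\vec{u})=s(\vec{v}\vec{u})$ and $s''(\vec{w})=s'(\vec{w})$. $X$ satisfies a conjunction if it satisfies every conjunct. $X$ satisfies locality if for all $s_0,\dots,s_{n-1}\in X$: if there is $s\in X$ with $s(x_i\vec{z})=s_i(x_i\vec{z})$ for all $i<n$, then there is $s'\in X$ with $s'(x_iy_i\vec{z})=s_i(x_iy_i\vec{z})$ for all $i<n$. *)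

theory Defs
  imports Main
begin

type_synonym ('v, 'a) assignment = "'v \<rightharpoonup> 'a"
type_synonym ('v, 'a) team = "('v, 'a) assignment set"

text \<open>The value of a tuple of variables. All variables in use lie in the domain of the
  assignment, so equality of the resulting lists of options is equality of the tuples of values.\<close>
definition tuple_val :: "('v, 'a) assignment \<Rightarrow> 'v list \<Rightarrow> 'a option list" where
  "tuple_val s vs = map s vs"

text \<open>\<open>Indep u v w\<close> is the atom written $\vec u \perp_{\vec v} \vec w$; the conditioning tuple
  is the middle argument. \<open>Conj\<close> is conjunction of a finite list of formulas.\<close>
datatype 'v formula =
    Indep "'v list" "'v list" "'v list"
  | Conj "'v formula list"

fun satisfies :: "('v, 'a) team \<Rightarrow> 'v formula \<Rightarrow> bool" where
  "satisfies X (Indep u v w) \<longleftrightarrow>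
     (\<forall>s\<in>X. \<forall>s'\<in>X. tuple_val s v = tuple_val s' v \<longrightarrow>
       (\<exists>s''\<in>X. tuple_val s'' (v @ u) = tuple_val s (v @ u) \<and> tuple_val s'' w = tuple_val s' w))"
| "satisfies X (Conj \<phi>s) \<longleftrightarrow> (\<forall>\<phi>\<in>set \<phi>s. satisfies X \<phi>)"

definition hidden_variable_team ::
  "nat \<Rightarrow> nat \<Rightarrow> 'v list \<Rightarrow> 'v list \<Rightarrow> 'v list \<Rightarrow> ('v, 'a) team \<Rightarrow> bool" where
  "hidden_variable_team n l x y z X \<longleftrightarrow>
     length x = n \<and> length y = n \<and> length z = l \<and> distinct (x @ y @ z) \<and>
     (\<forall>s\<in>X. dom s = set (x @ y @ z))"

definition locality :: "nat \<Rightarrow> 'v list \<Rightarrow> 'v list \<Rightarrow> 'v list \<Rightarrow> ('v, 'a) team \<Rightarrow> bool" where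
  "locality n x y z X \<longleftrightarrow>
     (\<forall>t :: nat \<Rightarrow> ('v, 'a) assignment. (\<forall>i<n. t i \<in> X) \<longrightarrow>
       (\<exists>s\<in>X. \<forall>i<n. tuple_val s (x ! i # z) = tuple_val (t i) (x ! i # z)) \<longrightarrow>
       (\<exists>s'\<in>X. \<forall>i<n. tuple_val s' (x ! i # y ! i # z) = tuple_val (t i) (x ! i # y ! i # z)))"

text \<open>The tuple listing $\{v_i \mid i < n,\ P(i)\}$ in increasing order of the index.\<close>
definition subtuple :: "nat \<Rightarrow> 'v list \<Rightarrow> (nat \<Rightarrow> bool) \<Rightarrow> 'v list" where
  "subtuple n v P = map (\<lambda>i. v ! i) (filter P [0..<n])"

text \<open>The list \<open>subseqs [0..<n]\<close> enumerates the subsets $I \subseteq \{0,\dots,n-1\}$, each as the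
  increasing list of its elements.\<close>
definition locality_formula :: "nat \<Rightarrow> 'v list \<Rightarrow> 'v list \<Rightarrow> 'v list \<Rightarrow> 'v formula" where
  "locality_formula n x y z =
     Conj
      [Conj (map (\<lambda>I. Indep (subtuple n x (\<lambda>i. i \<notin> I))
                            (subtuple n x (\<lambda>i. i \<in> I) @ z)
                            (subtuple n y (\<lambda>i. i \<in> I)))
               (map set (subseqs [0..<n]))),
       Conj (map (\<lambda>i. Indep [y ! i] (x @ z) (subtuple n y (\<lambda>j. j \<noteq> i))) [0..<n])]"

end

theory Submission
  imports Defs
begin

text \<open>Locality yields each atom by mixing two assignments coordinatewise: take \<open>t i\<close> to be one of
  them or the other according to which side of the atom \<open>y ! i\<close> occurs on. Conversely, the atoms
  with singleton \<open>I\<close> move each outcome of \<open>t i\<close> onto the measurements of the common \<open>s\<close>, and the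
  atoms for \<open>y ! i\<close> against the other outcomes then glue these together one outcome at a time.\<close>

lemma tuple_val_eq_iff: "tuple_val s v = tuple_val s' v \<longleftrightarrow> (\<forall>a\<in>set v. s a = s' a)"
  by (simp add: tuple_val_def)

lemma set_subtuple: "set (subtuple n v P) = {v ! i |i. i < n \<and> P i}"
  by (auto simp: subtuple_def)

lemma ball_set_subtuple: "(\<forall>a\<in>set (subtuple n v P). Q a) \<longleftrightarrow> (\<forall>i<n. P i \<longrightarrow> Q (v ! i))"
  by (auto simp: set_subtuple)

lemma satisfies_Indep_iff:
  "satisfies X (Indep u v w) \<longleftrightarrow>
     (\<forall>s\<in>X. \<forall>s'\<in>X. (\<forall>a\<in>set v. s a = s' a) \<longrightarrow>
       (\<exists>s''\<in>X. (\<forall>a\<in>set v \<union> set u. s'' a = s a) \<and> (\<forall>a\<in>set w. s'' a = s' a)))"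
  by (simp add: tuple_val_eq_iff)

lemma satisfies_locality_formula_iff:
  "satisfies X (locality_formula n x y z) \<longleftrightarrow>
     (\<forall>I\<subseteq>{..<n}. satisfies X (Indep (subtuple n x (\<lambda>i. i \<notin> I))
                                   (subtuple n x (\<lambda>i. i \<in> I) @ z)
                                   (subtuple n y (\<lambda>i. i \<in> I)))) \<and>
     (\<forall>i<n. satisfies X (Indep [y ! i] (x @ z) (subtuple n y (\<lambda>j. j \<noteq> i))))"
proof -
  let ?A = "\<lambda>I. satisfies X (Indep (subtuple n x (\<lambda>i. i \<notin> I)) (subtuple n x (\<lambda>i. i \<in> I) @ z)
                            (subtuple n y (\<lambda>i. i \<in> I)))"
  have "set (map set (subseqs [0..<n])) = {I. I \<subseteq> {..<n}}"
    by (simp add: subseqs_powset Pow_def lessThan_atLeast0)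
  then have "(\<forall>I\<in>set (map set (subseqs [0..<n])). ?A I) \<longleftrightarrow> (\<forall>I\<subseteq>{..<n}. ?A I)"
    by (simp only: mem_Collect_eq Ball_def)
  moreover have "(\<forall>i\<in>{0..<n}. P i) \<longleftrightarrow> (\<forall>i<n. P i)" for P
    by auto
  ultimately show ?thesis
    by (simp add: locality_formula_def del: satisfies.simps(1))
qed

text \<open>Elimination form of locality, stated variable by variable so that the choice of
  \<open>t i\<close> can depend on \<open>i\<close> by a conditional. Control over \<open>z\<close>
  comes only through an index below \<open>n\<close>.\<close>

lemma localityD:
  assumes "locality n x y z X" and "\<And>i. i < n \<Longrightarrow> t i \<in> X" and "s \<in> X"
    and "\<And>i a. i < n \<Longrightarrow> a \<in> insert (x ! i) (set z) \<Longrightarrow> s a = t i a"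
  obtains s' where "s' \<in> X"
    and "\<And>i a. i < n \<Longrightarrow> a \<in> insert (x ! i) (insert (y ! i) (set z)) \<Longrightarrow> s' a = t i a"
proof -
  have "\<exists>s\<in>X. \<forall>i<n. tuple_val s (x ! i # z) = tuple_val (t i) (x ! i # z)"
    using assms(3,4) by (auto simp: tuple_val_eq_iff)
  then obtain s' where "s' \<in> X"
    and "\<forall>i<n. tuple_val s' (x ! i # y ! i # z) = tuple_val (t i) (x ! i # y ! i # z)"
    using assms(1,2) unfolding locality_def by blast
  then show thesis
    by (intro that) (auto simp: tuple_val_eq_iff)
qed

lemma locality_imp_indep_subset:
  assumes loc: "locality n x y z X"
  shows "satisfies X (Indep (subtuple n x (\<lambda>i. i \<notin> I)) (subtuple n x (\<lambda>i. i \<in> I) @ z)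
                            (subtuple n y (\<lambda>i. i \<in> I)))"
\<comment> \<open>For \<open>n = 0\<close> locality yields an assignment with unconstrained values
  on \<open>z\<close>. All the subtuples are then empty, so the atom holds with \<open>s\<close>
  itself as witness.\<close>
proof (cases "n = 0")
  case True
  then show ?thesis
    unfolding satisfies_Indep_iff by (auto simp: set_subtuple)
next
  case False
  show ?thesis
    unfolding satisfies_Indep_iff set_append ball_Un ball_set_subtuple
  proof (intro ballI impI)
    fix s s'
    assume s: "s \<in> X" "s' \<in> X"
      and eq: "(\<forall>i<n. i \<in> I \<longrightarrow> s (x ! i) = s' (x ! i)) \<and> (\<forall>a\<in>set z. s a = s' a)"
    \<comment> \<open>Outcomes in \<open>I\<close> must come from \<open>s'\<close>, so the family
      picks \<open>s'\<close> there and \<open>s\<close> elsewhere. By \<open>eq\<close>,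
      \<open>s\<close> agrees with each member on its measurement and on \<open>z\<close>, so
      \<open>s\<close> is the common assignment that locality asks for.\<close>
    obtain r where r: "r \<in> X"
      and agree: "\<And>i a. i < n \<Longrightarrow> a \<in> insert (x ! i) (insert (y ! i) (set z)) \<Longrightarrow>
        r a = (if i \<in> I then s' else s) a"
      by (rule localityD[OF loc, of "\<lambda>i. if i \<in> I then s' else s" s]) (use s eq in auto)
    have "r (x ! i) = s (x ! i)" if "i < n" for i
      using agree[of i "x ! i"] eq that by (simp split: if_splits)
    \<comment> \<open>Any index determines the hidden values; index 0 exists because
      \<open>n\<close> is nonzero.\<close>
    moreover have "r a = s a" if "a \<in> set z" for a
      using agree[of 0 a] eq False that by (simp split: if_splits)
    moreover have "r (y ! i) = s' (y ! i)" if "i < n" "i \<in> I" for i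
      using agree[of i "y ! i"] that by simp
    ultimately show "\<exists>s''\<in>X. (((\<forall>i<n. i \<in> I \<longrightarrow> s'' (x ! i) = s (x ! i)) \<and>
         (\<forall>a\<in>set z. s'' a = s a)) \<and> (\<forall>i<n. i \<notin> I \<longrightarrow> s'' (x ! i) = s (x ! i))) \<and>
         (\<forall>i<n. i \<in> I \<longrightarrow> s'' (y ! i) = s' (y ! i))"
      using r by blast
  qed
qed

lemma locality_imp_indep_outcome:
  assumes loc: "locality n x y z X" and len: "length x = n" and i: "i < n"
  shows "satisfies X (Indep [y ! i] (x @ z) (subtuple n y (\<lambda>j. j \<noteq> i)))"
  unfolding satisfies_Indep_iff ball_set_subtuple
proof (intro ballI impI)
  fix s s'
  assume s: "s \<in> X" "s' \<in> X" and eq: "\<forall>a\<in>set (x @ z). s a = s' a"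
  \<comment> \<open>Only coordinate \<open>i\<close> follows \<open>s\<close>. Since
    \<open>s\<close> and \<open>s'\<close> agree on all measurements and on \<open>z\<close>,
    \<open>s\<close> again serves as the common assignment.\<close>
  obtain r where r: "r \<in> X"
    and agree: "\<And>j a. j < n \<Longrightarrow> a \<in> insert (x ! j) (insert (y ! j) (set z)) \<Longrightarrow>
      r a = (if j = i then s else s') a"
    by (rule localityD[OF loc, of "\<lambda>j. if j = i then s else s'" s]) (use s eq len in auto)
  have "r a = s a" if "a \<in> set (x @ z) \<union> set [y ! i]" for a
  proof -
    \<comment> \<open>A measurement \<open>x ! j\<close> is read off at its own index, where
      \<open>s\<close> and \<open>s'\<close> coincide; \<open>y ! i\<close> and \<open>z\<close> are
      read off at index \<open>i\<close>, where \<open>r\<close> follows \<open>s\<close>.\<close>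
    from that consider j where "j < n" "a = x ! j" | "a \<in> insert (y ! i) (set z)"
      using len by (auto simp: in_set_conv_nth)
    then show ?thesis
    proof cases
      case 1
      then show ?thesis
        using agree[of j a] eq len by (auto split: if_splits)
    qed (use agree[of i a] i in auto)
  qed
  moreover have "r (y ! j) = s' (y ! j)" if "j < n" "j \<noteq> i" for j
    using agree[of j "y ! j"] that by simp
  ultimately show "\<exists>s''\<in>X. (\<forall>a\<in>set (x @ z) \<union> set [y ! i]. s'' a = s a) \<and>
      (\<forall>j<n. j \<noteq> i \<longrightarrow> s'' (y ! j) = s' (y ! j))"
    using r by blast
qed

lemma locality_if_indep:
  assumes len: "length x = n"
    and singleton: "\<And>i. i < n \<Longrightarrow> satisfies X (Indep (subtuple n x (\<lambda>j. j \<notin> {i}))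
          (subtuple n x (\<lambda>j. j \<in> {i}) @ z) (subtuple n y (\<lambda>j. j \<in> {i})))"
    and outcome: "\<And>i. i < n \<Longrightarrow> satisfies X (Indep [y ! i] (x @ z) (subtuple n y (\<lambda>j. j \<noteq> i)))"
  shows "locality n x y z X"
  unfolding locality_def
proof (intro allI impI)
  fix t :: "nat \<Rightarrow> ('a, 'b) assignment"
  assume t: "\<forall>i<n. t i \<in> X"
    and "\<exists>s\<in>X. \<forall>i<n. tuple_val s (x ! i # z) = tuple_val (t i) (x ! i # z)"
  then obtain s where s: "s \<in> X"
    and eq: "\<And>i. i < n \<Longrightarrow> s (x ! i) = t i (x ! i)" "\<And>i a. i < n \<Longrightarrow> a \<in> set z \<Longrightarrow> s a = t i a"
    by (auto simp: tuple_val_eq_iff)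
  \<comment> \<open>The atom for \<open>{i}\<close> applies to \<open>s\<close> and
    \<open>t i\<close>, which agree on \<open>x ! i\<close> and \<open>z\<close>: the other
    measurements are kept from \<open>s\<close>, the outcome is taken from
    \<open>t i\<close>.\<close>
  have transfer: "\<exists>r\<in>X. (\<forall>a\<in>set (x @ z). r a = s a) \<and> r (y ! i) = t i (y ! i)" if i: "i < n" for i
  proof -
    obtain r where "r \<in> X" "\<forall>j<n. r (x ! j) = s (x ! j)" "\<forall>a\<in>set z. r a = s a"
      "r (y ! i) = t i (y ! i)"
      using singleton[OF i, unfolded satisfies_Indep_iff set_append ball_Un ball_set_subtuple,
          rule_format, of s "t i"] s t eq i by (auto, metis)
    then show ?thesis
      using len by (intro bexI[of _ r]) (auto simp: in_set_conv_nth)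
  qed
  \<comment> \<open>Gluing by induction: only the first \<open>k\<close> outcomes are prescribed,
    the rest are arbitrary.\<close>
  have "\<exists>q\<in>X. (\<forall>a\<in>set (x @ z). q a = s a) \<and> (\<forall>j<k. q (y ! j) = t j (y ! j))" if "k \<le> n" for k
    using that
  proof (induction k)
    case 0
    then show ?case
      using s by auto
  next
    case (Suc k)
    then obtain q where q: "q \<in> X" "\<forall>a\<in>set (x @ z). q a = s a" "\<forall>j<k. q (y ! j) = t j (y ! j)"
      by auto
    from Suc.prems obtain r where r: "r \<in> X" "\<forall>a\<in>set (x @ z). r a = s a" "r (y ! k) = t k (y ! k)"
      using transfer[of k] by auto
    from Suc.prems have k: "k < n"
      by simp
    \<comment> \<open>Both coincide with \<open>s\<close> on \<open>x @ z\<close>, so the atom for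
      \<open>y ! k\<close> applies with \<open>r\<close> first and \<open>q\<close> second:
      \<open>p\<close> gets outcome \<open>k\<close> from \<open>r\<close> and keeps all others, in
      particular those already correct, from \<open>q\<close>.\<close>
    have "\<forall>a\<in>set (x @ z). r a = q a"
      using q r by simp
    then obtain p where p: "p \<in> X" "\<forall>a\<in>set (x @ z) \<union> set [y ! k]. p a = r a"
      "\<forall>j<n. j \<noteq> k \<longrightarrow> p (y ! j) = q (y ! j)"
      using outcome[OF k] q(1) r(1) unfolding satisfies_Indep_iff ball_set_subtuple by blast
    have "p (y ! j) = t j (y ! j)" if "j < Suc k" for j
      using that p q r k by (cases "j = k") auto
    then show ?case
      using p r by (intro bexI[of _ p]) auto
  qed
  then obtain q where "q \<in> X" "\<forall>a\<in>set (x @ z). q a = s a" "\<forall>j<n. q (y ! j) = t j (y ! j)"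
    by blast
  \<comment> \<open>On \<open>x ! i\<close> and \<open>z\<close> the assignment \<open>q\<close>
    equals \<open>s\<close>, which matches \<open>t i\<close> there by \<open>eq\<close>.\<close>
  then show "\<exists>s'\<in>X. \<forall>i<n. tuple_val s' (x ! i # y ! i # z) = tuple_val (t i) (x ! i # y ! i # z)"
    using len eq by (intro bexI[of _ q]) (auto simp: tuple_val_eq_iff)
qed

theorem lemma3p16:
  fixes x y z :: "'v list" and n l :: nat and X :: "('v, 'a) team"
  assumes "hidden_variable_team n l x y z X"
  shows "locality n x y z X \<longleftrightarrow> satisfies X (locality_formula n x y z)"
proof
  have len: "length x = n"
    using assms by (simp add: hidden_variable_team_def)
  show "satisfies X (locality_formula n x y z)" if "locality n x y z X"
    unfolding satisfies_locality_formula_iff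
    using locality_imp_indep_subset[OF that] locality_imp_indep_outcome[OF that len] by blast
  show "locality n x y z X" if "satisfies X (locality_formula n x y z)"
    using that unfolding satisfies_locality_formula_iff
    by (intro locality_if_indep[OF len]) (auto simp del: satisfies.simps)
qed

end
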